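(* Let $a, b$ be integers with $1 \le a \le b$ and $a^2 \equiv a \bmod b$, let $M_{a,b} = \{n \in \mathbb{Z}_{\ge 1} : n \equiv a \bmod b\} \cup \{1\}$ be the corresponding arithmetic congruence monoid, and let $q = \gcd(a,b)$. Then the atomic density $\mathcal{D}(M_{a,b})$ satisfies $$\mathcal{D}(M_{a,b}) = \lim_{n \to \infty} \frac{|\mathcal{A}(M_{a,b}) \cap \{1, \ldots, n\}|}{|M_{a,b} \cap \{1, \ldots, n\}|} = 1 - \frac{1}{q}$$ (in particular, the limit exists).
   Context: For integers $a, b$ with $1 \le a \le b$ and $a^2 \equiv a \bmod b$, the set $M_{a,b} = \{n \in \mathbb{Z}_{\ge 1} : n \equiv a \bmod b\} \cup \{1\}$ is closed under multiplication, and is a multiplicative monoid called an arithmetic congruence monoid (ACM). Its only unit is $1$. A non-unit element $n \in M_{a,b}$ is an atom if it cannot be written as a product of two non-unit elements of $M_{a,b}$; $\mathcal{A}(M_{a,b})$ denotes the set of atoms of $M_{a,b}$. The atomic density of $M_{a,b}$ is $\mathcal{D}(M_{a,b}) = \lim_{n \to \infty} \frac{|\mathcal{A}(M_{a,b}) \cap \{1, \ldots, n\}|}{|M_{a,b} \cap \{1, \ldots, n\}|}$. *)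

theory Defs
  imports Complex_Main "HOL-Number_Theory.Cong" "HOL-Algebra.Group"
begin

definition acm :: "nat \<Rightarrow> nat \<Rightarrow> nat monoid" where
  "acm a b = \<lparr>carrier = {n. 1 \<le> n \<and> [n = a] (mod b)} \<union> {1}, mult = (*), one = 1\<rparr>"

definition atoms :: "('a, 'm) monoid_scheme \<Rightarrow> 'a set" where
  "atoms G = {n \<in> carrier G - Units G.
     \<not> (\<exists>x \<in> carrier G - Units G. \<exists>y \<in> carrier G - Units G. n = x \<otimes>\<^bsub>G\<^esub> y)}"

(* lim is underspecified for divergent sequences, so a statement about the
   value of atomic_density should be accompanied by one about convergence. *)
definition atomic_density :: "nat \<Rightarrow> nat \<Rightarrow> real" where
  "atomic_density a b =
     lim (\<lambda>n. real (card (atoms (acm a b) \<inter> {1..n})) / real (card (carrier (acm a b) \<inter> {1..n})))"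

lemma acm_comm_monoid:
  assumes "[a ^ 2 = a] (mod b)"
  shows "comm_monoid (acm a b)"
proof -
  have "[x * y = a] (mod b)" if "[x = a] (mod b)" "[y = a] (mod b)" for x y
    using cong_trans[OF cong_mult[OF that]] assms by (simp add: power2_eq_square)
  then show ?thesis
    by (intro comm_monoidI) (auto simp: acm_def)
qed

lemma Units_acm: "Units (acm a b) = {1}"
  by (auto simp: Units_def acm_def)

end

theory Submission
  imports Defs
begin

text \<open>Write \<open>b = q * r\<close> with \<open>q = gcd a b\<close>. Idempotency of \<open>a\<close> modulo \<open>b\<close> makes \<open>q\<close> and \<open>r\<close> coprime, and
  \<open>n \<equiv> a (mod b)\<close> means \<open>n \<equiv> 0 (mod q)\<close> and \<open>n \<equiv> 1 (mod r)\<close>. A product of two non-units is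
  divisible by \<open>q\<^sup>2\<close>, and the elements divisible by \<open>q\<^sup>2\<close> have relative density \<open>1/q\<close>. It therefore
  suffices that almost every such element \<open>q\<^sup>2 * m\<close> is a product of two non-units. This holds if
  \<open>m\<close> has a proper divisor \<open>u > 1\<close> with \<open>q * u \<equiv> 1 (mod r)\<close>: for \<open>m = u * v\<close> the factor
  \<open>q * v\<close> is then also \<open>1\<close> modulo \<open>r\<close>.

  So the point is that, for every \<open>c\<close> coprime to \<open>r\<close>, almost every integer has a divisor
  \<open>u \<equiv> c (mod r)\<close> with \<open>u > 1\<close>. This would follow from the divergence of \<open>\<Sum>1/p\<close> over the primes
  in the class of \<open>c\<close>, but a softer argument avoids Dirichlet's theorem. Call a class unavoidable
  if it has the property in question. A class in which the sum over primes diverges is unavoidable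
  (\<open>summable_primes_if_avoidable\<close>), and products of unavoidable classes are unavoidable
  (\<open>unavoidable_mult\<close>). If the class of \<open>c\<close> were avoidable, then every \<open>m > 1\<close> in it would have a
  prime factor from the set \<open>B\<close> of primes not dividing \<open>r\<close> in avoidable classes, and \<open>\<Sum>1/p\<close> converges
  over \<open>B\<close>. Requiring in addition \<open>m \<equiv> 1\<close> modulo each of the small primes of \<open>B\<close> leaves a full
  progression, all of whose members greater than \<open>1\<close> are divisible by a large prime of \<open>B\<close>;
  the small tail of the convergent series makes this impossible (\<open>unavoidable_if_coprime\<close>).\<close>

section \<open>Counting in progressions and sieving by finitely many primes\<close>

lemma card_progression:
  fixes m c N :: nat
  assumes "0 < m"
  shows "\<bar>real (card ({n. [n = c] (mod m)} \<inter> {1..N})) - real N / real m\<bar> \<le> 1"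
proof -
  \<comment> \<open>the least positive representative of the class of \<open>c\<close>\<close>
  define d where "d = (if c mod m = 0 then m else c mod m)"
  have d: "1 \<le> d" "d \<le> m" "[c = d] (mod m)"
    using assms by (auto simp: d_def cong_def less_imp_le)
  have eq: "{n. [n = c] (mod m)} \<inter> {1..N} = (\<lambda>k. d + k * m) ` {k. d + k * m \<le> N}"
  proof (intro equalityI subsetI)
    fix n assume n: "n \<in> {n. [n = c] (mod m)} \<inter> {1..N}"
    have nd: "[n = d] (mod m)"
      using n d(3) cong_trans by blast
    have "d \<le> n"
    proof (rule ccontr)
      assume "\<not> d \<le> n"
      then have "n < m" "n \<noteq> d" using d by auto
      then have "n mod m = n" by simp
      moreover have "d mod m = (if d = m then 0 else d)"
        using d by auto
      ultimately show False
        using nd n \<open>n \<noteq> d\<close> by (auto simp: cong_def split: if_splits)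
    qed
    then have "m dvd n - d"
      using nd by (metis cong_altdef_nat)
    then obtain k where "n - d = m * k" by (elim dvdE)
    then have "n = d + k * m" using \<open>d \<le> n\<close> by (simp add: mult.commute)
    then show "n \<in> (\<lambda>k. d + k * m) ` {k. d + k * m \<le> N}" using n by auto
  next
    fix n assume "n \<in> (\<lambda>k. d + k * m) ` {k. d + k * m \<le> N}"
    then obtain k where k: "n = d + k * m" "n \<le> N" by auto
    have "[n = d] (mod m)" by (simp add: k(1) cong_def)
    then have "[n = c] (mod m)" using d(3) cong_sym cong_trans by blast
    then show "n \<in> {n. [n = c] (mod m)} \<inter> {1..N}" using k d by auto
  qed
  have card: "card ({n. [n = c] (mod m)} \<inter> {1..N}) = card {k. d + k * m \<le> N}"
    unfolding eq by (rule card_image) (use assms in \<open>auto simp: inj_on_def\<close>)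
  have mr: "real m > 0" using assms by simp
  show ?thesis
  proof (cases "d \<le> N")
    case False
    then have "{k. d + k * m \<le> N} = {}" by auto
    moreover have "real N / real m \<le> 1" using False d mr by (simp add: field_simps)
    ultimately show ?thesis unfolding card by simp
  next
    case True
    have "{k. d + k * m \<le> N} = {..(N - d) div m}"
      using assms True by (auto simp: less_eq_div_iff_mult_less_eq)
    then have c1: "card {k. d + k * m \<le> N} = (N - d) div m + 1" by simp
    define t where "t = (N - d) div m"
    have "t * m \<le> N - d" "N - d < (t + 1) * m"
      using assms dividend_less_div_times[of m "N - d"]
      by (auto simp: t_def algebra_simps)
    then have "t * m + d \<le> N" "N < t * m + m + d" using True by auto
    then have t: "real t * real m + real d \<le> real N" "real N < real t * real m + real m + real d"
      by (metis of_nat_add of_nat_mult of_nat_le_iff, metis of_nat_add of_nat_mult of_nat_less_iff)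
    have "real t \<le> real N / real m" "real N / real m \<le> real t + 2"
      using t mr d by (auto simp: field_simps)
    then show ?thesis unfolding card c1 t_def[symmetric] by simp
  qed
qed

text \<open>Induction on \<open>F\<close>: the integers up to \<open>N\<close> that are free of \<open>F\<close> but divisible by a further
  prime \<open>p\<close> are the multiples \<open>p * m\<close> of the \<open>F\<close>-free integers \<open>m\<close> up to \<open>N div p\<close>.\<close>
lemma sieve_density:
  fixes F :: "nat set"
  assumes "finite F" "\<And>p. p \<in> F \<Longrightarrow> prime p"
  shows "\<exists>C. \<forall>N. \<bar>real (card ({n. \<forall>p\<in>F. \<not> p dvd n} \<inter> {1..N}))
                   - (\<Prod>p\<in>F. 1 - 1 / real p) * real N\<bar> \<le> C"
  using assms
proof (induction F rule: finite_induct)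
  case empty
  then show ?case by auto
next
  case (insert p F)
  let ?S = "\<lambda>F. {n. \<forall>p\<in>F. \<not> p dvd n} :: nat set"
  let ?d = "\<Prod>p\<in>F. 1 - 1 / real p"
  have p: "prime p" using insert by auto
  have p0: "p > 0" using p prime_gt_0_nat by auto
  obtain C where C: "\<bar>real (card (?S F \<inter> {1..N})) - ?d * real N\<bar> \<le> C" for N
    using insert by auto
  have d01: "0 \<le> ?d" "?d \<le> 1"
    using insert.prems by (auto intro!: prod_nonneg prod_le_1 simp: field_simps Suc_leI prime_gt_0_nat)
  have "\<bar>real (card (?S (insert p F) \<inter> {1..N})) - (\<Prod>p\<in>insert p F. 1 - 1 / real p) * real N\<bar>
          \<le> 2 * C + 1" for N
  proof -
    let ?M = "(\<lambda>m. p * m) ` (?S F \<inter> {1..N div p})"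
    have F: "\<not> q dvd p" if "q \<in> F" for q
      using that insert.prems insert.hyps p primes_dvd_imp_eq by (metis insertCI)
    have eq: "?S (insert p F) \<inter> {1..N} = (?S F \<inter> {1..N}) - ?M"
    proof (intro equalityI subsetI)
      fix n assume n: "n \<in> ?S F \<inter> {1..N} - ?M"
      have "\<not> p dvd n"
      proof
        assume "p dvd n"
        then obtain m where m: "n = p * m" by (elim dvdE)
        have "m \<in> ?S F \<inter> {1..N div p}"
          using n m p0 by (auto simp: less_eq_div_iff_mult_less_eq mult.commute)
        then show False using n m by blast
      qed
      then show "n \<in> ?S (insert p F) \<inter> {1..N}" using n by auto
    qed auto
    have sub: "?M \<subseteq> ?S F \<inter> {1..N}"
    proof
      fix n assume "n \<in> ?M"
      then obtain m where n: "n = p * m" and "m \<in> ?S F \<inter> {1..N div p}" by blast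
      then have m: "n = p * m" "m \<in> ?S F" "1 \<le> m" "m \<le> N div p" by auto
      have "\<not> q dvd n" if "q \<in> F" for q
        using that m F insert.prems by (auto simp: prime_dvd_mult_iff)
      moreover have "n \<le> N" using m p0 by (simp add: less_eq_div_iff_mult_less_eq mult.commute)
      ultimately show "n \<in> ?S F \<inter> {1..N}" using m p0 by auto
    qed
    have cM: "card ?M = card (?S F \<inter> {1..N div p})"
      using p0 by (intro card_image) (auto simp: inj_on_def)
    have "card (?S (insert p F) \<inter> {1..N}) + card ?M = card (?S F \<inter> {1..N})"
      unfolding eq using sub card_mono[OF _ sub] by (subst card_Diff_subset) auto
    then have e1: "real (card (?S (insert p F) \<inter> {1..N}))
        = real (card (?S F \<inter> {1..N})) - real (card (?S F \<inter> {1..N div p}))"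
      unfolding cM by linarith
    have "real (N div p) \<le> real N / real p" "real N / real p \<le> real (N div p) + 1"
      using floor_divide_of_nat_eq[of N p, where 'a = real] by linarith+
    then have "\<bar>real (N div p) - real N / real p\<bar> \<le> 1" by linarith
    then have "\<bar>?d * real (N div p) - ?d * (real N / real p)\<bar> \<le> 1"
      unfolding right_diff_distrib[symmetric] abs_mult
      using d01 by (intro mult_le_one) auto
    moreover have "(\<Prod>p\<in>insert p F. 1 - 1 / real p) * real N
        = ?d * real N - ?d * (real N / real p)"
      using insert by (simp add: algebra_simps)
    ultimately show ?thesis using e1 C[of N] C[of "N div p"] by linarith
  qed
  then show ?case by blast
qed

text \<open>The set \<open>A\<close> has upper density at most \<open>e\<close>; a bounded error is built in, which costs
  nothing below because the sets to be measured are periodic.\<close>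
definition upper_density_le :: "nat set \<Rightarrow> real \<Rightarrow> bool" where
  "upper_density_le A e \<longleftrightarrow> (\<exists>C. \<forall>N. real (card (A \<inter> {1..N})) \<le> e * real N + C)"

lemma upper_density_le_Un:
  assumes "upper_density_le A d" "upper_density_le B e" "S \<subseteq> A \<union> B"
  shows "upper_density_le S (d + e)"
proof -
  obtain C D where C: "\<And>N. real (card (A \<inter> {1..N})) \<le> d * real N + C"
    and D: "\<And>N. real (card (B \<inter> {1..N})) \<le> e * real N + D"
    using assms unfolding upper_density_le_def by blast
  have "real (card (S \<inter> {1..N})) \<le> (d + e) * real N + (C + D)" for N
  proof -
    have "card (S \<inter> {1..N}) \<le> card ((A \<inter> {1..N}) \<union> (B \<inter> {1..N}))"
      using assms(3) by (intro card_mono) auto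
    also have "\<dots> \<le> card (A \<inter> {1..N}) + card (B \<inter> {1..N})" by (rule card_Un_le)
    finally show ?thesis using C[of N] D[of N] by (simp add: algebra_simps)
  qed
  then show ?thesis unfolding upper_density_le_def by blast
qed

section \<open>Residue classes that almost every integer meets in a divisor\<close>

text \<open>The class of \<open>c\<close> modulo \<open>r\<close> is unavoidable if, up to a set of arbitrarily small upper
  density, all integers have a divisor in it from a finite set of divisors \<open>u > 1\<close>. The prime
  factors of these divisors may be taken beyond any bound \<open>z\<close>; this makes the notion
  multiplicative.\<close>
definition unavoidable :: "nat \<Rightarrow> nat \<Rightarrow> bool" where
  "unavoidable r c \<longleftrightarrow> (\<forall>e>0. \<forall>z. \<exists>U. finite U
     \<and> (\<forall>u\<in>U. [u = c] (mod r) \<and> 1 < u \<and> (\<forall>p. prime p \<and> p dvd u \<longrightarrow> z < p))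
     \<and> upper_density_le {n. \<forall>u\<in>U. \<not> u dvd n} e)"

lemma unavoidableE:
  assumes "unavoidable r c" "0 < e"
  obtains U where "finite U" "\<And>u. u \<in> U \<Longrightarrow> [u = c] (mod r)" "\<And>u. u \<in> U \<Longrightarrow> 1 < u"
    "\<And>u p. u \<in> U \<Longrightarrow> prime p \<Longrightarrow> p dvd u \<Longrightarrow> z < p"
    "upper_density_le {n. \<forall>u\<in>U. \<not> u dvd n} e"
proof -
  have "\<exists>U. finite U
     \<and> (\<forall>u\<in>U. [u = c] (mod r) \<and> 1 < u \<and> (\<forall>p. prime p \<and> p dvd u \<longrightarrow> z < p))
     \<and> upper_density_le {n. \<forall>u\<in>U. \<not> u dvd n} e"
    using assms unfolding unavoidable_def by blast
  then show ?thesis using that by blast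
qed

lemma unavoidable_cong:
  assumes "unavoidable r c" "[c = d] (mod r)"
  shows "unavoidable r d"
proof -
  have "[u = c] (mod r) \<longleftrightarrow> [u = d] (mod r)" for u
    using assms(2) cong_sym cong_trans by blast
  then show ?thesis using assms(1) unfolding unavoidable_def by simp
qed

lemma unavoidable_mult:
  assumes "unavoidable r c" "unavoidable r d"
  shows "unavoidable r (c * d)"
  unfolding unavoidable_def
proof (intro allI impI)
  fix e :: real and z :: nat
  assume "0 < e"
  then have e: "0 < e / 2" by simp
  obtain U where U: "finite U" "\<And>u. u \<in> U \<Longrightarrow> [u = c] (mod r)" "\<And>u. u \<in> U \<Longrightarrow> 1 < u"
    "\<And>u p. u \<in> U \<Longrightarrow> prime p \<Longrightarrow> p dvd u \<Longrightarrow> z < p"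
    "upper_density_le {n. \<forall>u\<in>U. \<not> u dvd n} (e / 2)"
    by (rule unavoidableE[OF assms(1) e, where z = z]) blast
  \<comment> \<open>the second family uses only primes exceeding every element of the first one\<close>
  obtain V where V: "finite V" "\<And>v. v \<in> V \<Longrightarrow> [v = d] (mod r)" "\<And>v. v \<in> V \<Longrightarrow> 1 < v"
    "\<And>v p. v \<in> V \<Longrightarrow> prime p \<Longrightarrow> p dvd v \<Longrightarrow> z + \<Sum>U < p"
    "upper_density_le {n. \<forall>v\<in>V. \<not> v dvd n} (e / 2)"
    by (rule unavoidableE[OF assms(2) e, where z = "z + \<Sum>U"]) blast
  define W where "W = (\<lambda>(u, v). u * v) ` (U \<times> V)"
  have cop: "coprime u v" if "u \<in> U" "v \<in> V" for u v
  proof (rule ccontr)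
    assume "\<not> coprime u v"
    then have "gcd u v \<noteq> 1" using gcd_eq_1_imp_coprime by blast
    then obtain p where "prime p" "p dvd gcd u v" using prime_factor_nat by blast
    then have p: "prime p" "p dvd u" "p dvd v" by simp_all
    have "p \<le> u" using p(2) U(3)[OF that(1)] by (intro dvd_imp_le) auto
    also have "u \<le> \<Sum>U" using that U(1) by (intro member_le_sum) auto
    finally show False using V(4)[OF that(2) p(1,3)] by simp
  qed
  have "[w = c * d] (mod r) \<and> 1 < w \<and> (\<forall>p. prime p \<and> p dvd w \<longrightarrow> z < p)"
    if wW: "w \<in> W" for w
  proof -
    obtain u v where w: "w = u * v" "u \<in> U" "v \<in> V" using wW by (auto simp: W_def)
    have "1 < w" unfolding w(1) using U(3)[OF w(2)] V(3)[OF w(3)] by (rule less_1_mult)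
    moreover have "z < p" if "prime p" "p dvd w" for p
    proof -
      have "p dvd u \<or> p dvd v" using that w(1) prime_dvd_multD by blast
      then show ?thesis using U(4)[OF w(2) that(1)] V(4)[OF w(3) that(1)] by auto
    qed
    ultimately show ?thesis unfolding w(1) using cong_mult[OF U(2)[OF w(2)] V(2)[OF w(3)]] by auto
  qed
  moreover have "finite W" using U V by (auto simp: W_def)
  moreover have "{n. \<forall>w\<in>W. \<not> w dvd n} \<subseteq> {n. \<forall>u\<in>U. \<not> u dvd n} \<union> {n. \<forall>v\<in>V. \<not> v dvd n}"
    using divides_mult[OF _ _ cop] by (fastforce simp: W_def)
  then have "upper_density_le {n. \<forall>w\<in>W. \<not> w dvd n} (e / 2 + e / 2)"
    using upper_density_le_Un[OF U(5) V(5)] by blast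
  ultimately show "\<exists>W. finite W
     \<and> (\<forall>w\<in>W. [w = c * d] (mod r) \<and> 1 < w \<and> (\<forall>p. prime p \<and> p dvd w \<longrightarrow> z < p))
     \<and> upper_density_le {n. \<forall>w\<in>W. \<not> w dvd n} e" by auto
qed

lemma unavoidable_if_prime_factors:
  assumes "1 < m" "\<And>p. prime p \<Longrightarrow> p dvd m \<Longrightarrow> unavoidable r p"
  shows "unavoidable r m"
  using assms
proof (induction m rule: less_induct)
  case (less m)
  obtain p where p: "prime p" "p dvd m"
    using less.prems(1) prime_factor_nat by (metis less_irrefl)
  then obtain k where k: "m = p * k" by (elim dvdE)
  show ?case
  proof (cases "k = 1")
    case True
    then show ?thesis using k p less.prems by simp
  next
    case False
    then have "1 < k" using k less.prems(1) by (cases k) auto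
    moreover have "k < m" using k p \<open>1 < k\<close> prime_gt_1_nat by simp
    ultimately have "unavoidable r k" using less k by auto
    then show ?thesis using less.prems(2)[OF p] unavoidable_mult k by simp
  qed
qed

text \<open>If the reciprocals of the primes in a class diverge, then sieving by enough of these primes
  leaves a set of density at most \<open>\<Prod>(1 - 1/p) \<le> exp (-\<Sum>1/p)\<close>, which is as small as
  desired.\<close>
lemma summable_primes_if_avoidable:
  assumes "\<not> unavoidable r c"
  shows "summable (\<lambda>p. if prime p \<and> [p = c] (mod r) then 1 / real p else 0)"
proof -
  obtain e z where e: "0 < e" and no: "\<not> (\<exists>U. finite U
      \<and> (\<forall>u\<in>U. [u = c] (mod r) \<and> 1 < u \<and> (\<forall>p. prime p \<and> p dvd u \<longrightarrow> z < p))
      \<and> upper_density_le {n. \<forall>u\<in>U. \<not> u dvd n} e)"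
    using assms unfolding unavoidable_def not_all not_imp by (elim exE conjE)
  define g where "g p = (if z < p \<and> prime p \<and> [p = c] (mod r) then 1 / real p else 0)" for p
  have "sum g {..<N} \<le> - ln e" for N
  proof -
    define F where "F = {p \<in> {..<N}. z < p \<and> prime p \<and> [p = c] (mod r)}"
    have F: "finite F" "\<And>p. p \<in> F \<Longrightarrow> prime p" by (auto simp: F_def)
    let ?d = "\<Prod>p\<in>F. 1 - 1 / real p"
    obtain C where C: "\<And>N. \<bar>real (card ({n. \<forall>p\<in>F. \<not> p dvd n} \<inter> {1..N})) - ?d * real N\<bar> \<le> C"
      using sieve_density[OF F] by blast
    have "e < ?d"
    proof (rule ccontr)
      assume "\<not> e < ?d"
      then have "?d * real N \<le> e * real N" for N by (intro mult_right_mono) auto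
      then have "real (card ({n. \<forall>p\<in>F. \<not> p dvd n} \<inter> {1..N})) \<le> e * real N + C" for N
        using C[of N] by (smt (verit))
      then have "upper_density_le {n. \<forall>p\<in>F. \<not> p dvd n} e"
        unfolding upper_density_le_def by blast
      moreover have "\<forall>u\<in>F. [u = c] (mod r) \<and> 1 < u \<and> (\<forall>p. prime p \<and> p dvd u \<longrightarrow> z < p)"
        using prime_gt_1_nat primes_dvd_imp_eq by (auto simp only: F_def mem_Collect_eq)
      ultimately show False using no F(1) by blast
    qed
    also have "?d \<le> (\<Prod>p\<in>F. exp (- (1 / real p)))"
    proof (rule prod_mono)
      fix p assume "p \<in> F"
      then have "1 \<le> p" using F(2) prime_ge_1_nat by blast
      then show "0 \<le> 1 - 1 / real p \<and> 1 - 1 / real p \<le> exp (- (1 / real p))"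
        using exp_ge_add_one_self[of "- (1 / real p)"] by (auto simp: field_simps)
    qed
    also have "\<dots> = exp (- (\<Sum>p\<in>F. 1 / real p))"
      using F(1) by (simp add: exp_sum sum_negf[symmetric])
    finally have "ln e < - (\<Sum>p\<in>F. 1 / real p)" using e by (metis exp_less_cancel_iff exp_ln)
    moreover have "sum g {..<N} = (\<Sum>p\<in>F. 1 / real p)"
      unfolding F_def g_def by (rule sum.inter_filter[symmetric]) simp
    ultimately show ?thesis by simp
  qed
  then have sg: "summable g" by (intro summableI_nonneg_bounded[of g]) (auto simp: g_def)
  have "eventually (\<lambda>p. g p = (if prime p \<and> [p = c] (mod r) then 1 / real p else 0)) sequentially"
    using eventually_gt_at_top[of z] by eventually_elim (auto simp: g_def)
  from summable_cong[OF this] sg show ?thesis by simp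
qed

text \<open>There are only \<open>r\<close> classes, so the preceding series may be added up over the avoidable ones.\<close>
lemma summable_avoidable_primes:
  assumes "0 < r"
  shows "summable (\<lambda>p. if prime p \<and> \<not> unavoidable r p then 1 / real p else 0)"
proof -
  let ?g = "\<lambda>c p. if \<not> unavoidable r c \<and> prime p \<and> [p = c] (mod r) then 1 / real p else 0"
  have "summable (?g c)" for c
    using summable_primes_if_avoidable[of r c] by (cases "unavoidable r c") auto
  then have "summable (\<lambda>p. \<Sum>c<r. ?g c p)" by (intro summable_sum)
  moreover have "(\<Sum>c<r. ?g c p) = (if prime p \<and> \<not> unavoidable r p then 1 / real p else 0)" for p
  proof -
    have "?g c p = (if c = p mod r then (if prime p \<and> \<not> unavoidable r p then 1 / real p else 0) else 0)"
      if "c < r" for c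
    proof -
      have "[p = c] (mod r) \<longleftrightarrow> c = p mod r" using that by (auto simp: cong_def)
      moreover have "unavoidable r (p mod r) = unavoidable r p"
        using unavoidable_cong by (metis cong_mod_left cong_refl cong_sym)
      ultimately show ?thesis by auto
    qed
    then have "(\<Sum>c<r. ?g c p)
        = (\<Sum>c<r. if c = p mod r then (if prime p \<and> \<not> unavoidable r p then 1 / real p else 0) else 0)"
      by (intro sum.cong) auto
    then show ?thesis using assms by simp
  qed
  ultimately show ?thesis by simp
qed

text \<open>The proof estimates the members up to \<open>N\<close> of a progression \<open>D\<close> of modulus \<open>Q\<close>, each of
  which other than \<open>1\<close> has a prime factor \<open>p \<ge> z\<close> in \<open>B\<close>. A given \<open>p\<close> accounts for at most
  \<open>N/(p * Q) + 1\<close> of them; the main terms sum to at most \<open>N/(4 * Q)\<close>, and so do the summands \<open>1\<close> up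
  to a constant, which leaves fewer than the roughly \<open>N/Q\<close> members of \<open>D\<close>.\<close>
lemma unavoidable_if_coprime:
  assumes "0 < r" "coprime c r"
  shows "unavoidable r c"
proof (rule ccontr)
  assume bad: "\<not> unavoidable r c"
  define B where "B = {p. prime p \<and> \<not> unavoidable r p \<and> \<not> p dvd r}"
  define f where "f p = (if p \<in> B then 1 / real p else 0)" for p
  have primeB: "prime p" if "p \<in> B" for p using that by (simp add: B_def)
  have summ: "summable f"
    using summable_avoidable_primes[OF assms(1)]
    by (rule summable_comparison_test'[where N = 0]) (auto simp: f_def B_def)
  have ex: "\<exists>p\<in>B. p dvd m" if "[m = c] (mod r)" "1 < m" for m
  proof (rule ccontr)
    assume none: "\<not> (\<exists>p\<in>B. p dvd m)"
    have cm: "coprime m r"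
      using assms(2) that(1) cong_imp_coprime cong_sym by blast
    have "unavoidable r p" if "prime p" "p dvd m" for p
    proof -
      have "\<not> p dvd r"
        using cm that coprime_common_divisor_nat[of m r p] by auto
      then show ?thesis using none that by (auto simp: B_def)
    qed
    then have "unavoidable r m" by (rule unavoidable_if_prime_factors[OF that(2)])
    then show False using bad unavoidable_cong that(1) by blast
  qed
  obtain z where z: "\<And>m n. z \<le> m \<Longrightarrow> norm (\<Sum>k=m..n. f k) < 1 / 4"
    using summable_partial_sum_bound[OF summ, of "1/4"] by auto
  define P where "P = \<Prod>{p\<in>B. p < z}"
  define Q where "Q = r * P"
  have P0: "0 < P" unfolding P_def by (rule prod_pos) (auto simp: B_def prime_gt_0_nat)
  have Q0: "0 < Q" using P0 assms by (simp add: Q_def)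
  have copP: "coprime r P"
    unfolding P_def by (rule prod_coprime_right) (auto simp: B_def prime_imp_coprime coprime_commute)
  \<comment> \<open>a subprogression of the class of \<open>c\<close> without prime factors in \<open>B\<close> below \<open>z\<close>\<close>
  obtain x where x: "[x = c] (mod r)" "[x = 1] (mod P)"
    using binary_chinese_remainder_nat[OF copP] by blast
  define D where "D = {n. [n = x] (mod Q)}"
  have Dz: "\<exists>p\<in>B. z \<le> p \<and> p dvd m" if mD: "m \<in> D" and m1: "1 < m" for m
  proof -
    have m: "[m = c] (mod r)" "[m = 1] (mod P)"
      using mD x unfolding D_def Q_def
      by (metis mem_Collect_eq cong_modulus_mult_nat cong_trans mult.commute)+
    then obtain p where p: "p \<in> B" "p dvd m" using ex[OF _ m1] by auto
    have "z \<le> p"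
    proof (rule ccontr)
      assume "\<not> z \<le> p"
      then have "p dvd P" using p unfolding P_def by (intro dvd_prodI) auto
      then have "[m = 1] (mod p)" using m(2) cong_dvd_modulus_nat by blast
      then have "p dvd 1" using p(2) cong_dvd_iff by blast
      then show False using primeB[OF p(1)] by simp
    qed
    then show ?thesis using p by blast
  qed
  have Dp: "real (card (D \<inter> {n. p dvd n} \<inter> {1..N})) \<le> real N / real Q * f p + 1"
    if "p \<in> B" "z \<le> p" for p N
  proof -
    have p: "prime p" using primeB that by blast
    have "coprime p P"
      unfolding P_def
      by (rule prod_coprime_right) (use that p primeB in \<open>auto intro: primes_coprime\<close>)
    moreover have "coprime p r" using that p by (auto simp: B_def prime_imp_coprime)
    ultimately have cop: "coprime Q p" by (simp add: Q_def coprime_commute)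
    obtain y where y: "[y = x] (mod Q)" "[y = 0] (mod p)"
      using binary_chinese_remainder_nat[OF cop] by blast
    have "D \<inter> {n. p dvd n} \<subseteq> {n. [n = y] (mod (Q * p))}"
    proof
      fix n assume "n \<in> D \<inter> {n. p dvd n}"
      then have "[n = y] (mod Q)" "[n = y] (mod p)"
        using y unfolding D_def by (metis IntE mem_Collect_eq cong_0_iff cong_sym cong_trans)+
      then show "n \<in> {n. [n = y] (mod (Q * p))}"
        using coprime_cong_mult_nat[OF _ _ cop] by simp
    qed
    then have "card (D \<inter> {n. p dvd n} \<inter> {1..N}) \<le> card ({n. [n = y] (mod (Q * p))} \<inter> {1..N})"
      by (intro card_mono) auto
    also have "real \<dots> \<le> real N / real (Q * p) + 1"
      using card_progression[of "Q * p" y N] Q0 p prime_gt_0_nat[of p] by simp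
    finally show ?thesis using that by (simp add: f_def)
  qed
  \<comment> \<open>convergence also bounds the number of primes of \<open>B\<close> up to \<open>N\<close> by a small multiple of \<open>N\<close>\<close>
  obtain w where w: "\<And>m n. w \<le> m \<Longrightarrow> norm (\<Sum>k=m..n. f k) < 1 / (4 * real Q)"
    using summable_partial_sum_bound[OF summ, of "1 / (4 * real Q)"] Q0 by auto
  have main: "real N / real Q / 2 \<le> 2 + real w" for N
  proof -
    define t where "t = real N / real Q"
    let ?BN = "{p \<in> {z..N}. p \<in> B}"
    have "{p \<in> {z..N}. p \<in> B} \<subseteq> {..<w} \<union> {p \<in> {w..N}. p \<in> B}" by auto
    then have "card ?BN \<le> card ({..<w} \<union> {p \<in> {w..N}. p \<in> B})" by (intro card_mono) auto
    also have "\<dots> \<le> w + card {p \<in> {w..N}. p \<in> B}"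
      using card_Un_le[of "{..<w}" "{p \<in> {w..N}. p \<in> B}"] by simp
    finally have b1: "real (card ?BN) \<le> real w + real (card {p \<in> {w..N}. p \<in> B})" by simp
    have "real (card {p \<in> {w..N}. p \<in> B}) = (\<Sum>p \<in> {p \<in> {w..N}. p \<in> B}. 1)" by simp
    also have "\<dots> \<le> (\<Sum>p \<in> {p \<in> {w..N}. p \<in> B}. real N * (1 / real p))"
      by (rule sum_mono) (use primeB prime_gt_0_nat in \<open>auto simp: field_simps\<close>)
    also have "\<dots> = real N * (\<Sum>p=w..N. f p)"
      by (simp add: f_def sum.inter_filter[symmetric] sum_distrib_left)
    also have "\<dots> \<le> real N * (1 / (4 * real Q))"
      using w[of w N] by (intro mult_left_mono) auto
    finally have b2: "real (card ?BN) \<le> real w + real N / real Q / 4" using b1 by simp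
    have "D \<inter> {1..N} \<subseteq> {1} \<union> (\<Union>p\<in>?BN. D \<inter> {n. p dvd n} \<inter> {1..N})"
    proof
      fix n assume n: "n \<in> D \<inter> {1..N}"
      show "n \<in> {1} \<union> (\<Union>p\<in>?BN. D \<inter> {n. p dvd n} \<inter> {1..N})"
      proof (cases "n = 1")
        case False
        then obtain p where p: "p \<in> B" "z \<le> p" "p dvd n" using Dz[of n] n by auto
        have "p \<le> n" using p(3) n by (intro dvd_imp_le) auto
        then have "p \<in> ?BN" using n p by auto
        then show ?thesis using n p by blast
      qed simp
    qed
    then have "card (D \<inter> {1..N}) \<le> card ({1} \<union> (\<Union>p\<in>?BN. D \<inter> {n. p dvd n} \<inter> {1..N}))"
      by (intro card_mono) auto
    also have "\<dots> \<le> 1 + card (\<Union>p\<in>?BN. D \<inter> {n. p dvd n} \<inter> {1..N})"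
      using card_Un_le[of "{1::nat}"] by simp
    also have "\<dots> \<le> 1 + (\<Sum>p\<in>?BN. card (D \<inter> {n. p dvd n} \<inter> {1..N}))"
      by (intro add_left_mono card_UN_le) simp
    finally have "real (card (D \<inter> {1..N})) \<le> real (1 + (\<Sum>p\<in>?BN. card (D \<inter> {n. p dvd n} \<inter> {1..N})))"
      by (rule of_nat_mono)
    also have "\<dots> = 1 + (\<Sum>p\<in>?BN. real (card (D \<inter> {n. p dvd n} \<inter> {1..N})))"
      unfolding of_nat_add of_nat_sum of_nat_1 ..
    also have "\<dots> \<le> 1 + (\<Sum>p\<in>?BN. real N / real Q * f p + 1)"
      by (intro add_left_mono sum_mono Dp) auto
    also have "(\<Sum>p\<in>?BN. real N / real Q * f p + 1) = real N / real Q * (\<Sum>p\<in>?BN. f p) + real (card ?BN)"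
      by (simp add: sum.distrib sum_distrib_left)
    also have "(\<Sum>p\<in>?BN. f p) = (\<Sum>p=z..N. f p)"
      by (rule sum.mono_neutral_left) (auto simp: f_def)
    also have "real N / real Q * \<dots> \<le> real N / real Q * (1 / 4)"
      using z[of z N] by (intro mult_left_mono) auto
    finally have "real (card (D \<inter> {1..N})) \<le> 1 + (real N / real Q / 4 + real (card ?BN))" by simp
    then show ?thesis
      using b2 card_progression[OF Q0, of x N]
      unfolding D_def t_def[symmetric] by linarith
  qed
  have "real (Q * (2 * (w + 3))) / real Q / 2 = real w + 3" using Q0 by simp
  then show False using main[of "Q * (2 * (w + 3))"] by linarith
qed

section \<open>Atoms of an arithmetic congruence monoid\<close>

lemma tendsto_ratio_if_approx:
  fixes x :: "nat \<Rightarrow> real"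
  assumes "\<And>e. 0 < e \<Longrightarrow> \<exists>C. \<forall>N. \<bar>x N - d * real N\<bar> \<le> e * real N + C"
  shows "(\<lambda>N. x N / real N) \<longlonglongrightarrow> d"
proof (rule LIMSEQ_I)
  fix e :: real assume "0 < e"
  then have "0 < e / 2" by simp
  then obtain C where C: "\<And>N. \<bar>x N - d * real N\<bar> \<le> e / 2 * real N + C"
    using assms by blast
  obtain K where K: "2 * C / e < real K" using reals_Archimedean2 by blast
  have "norm (x N / real N - d) < e" if "max 1 K \<le> N" for N
  proof -
    have N: "0 < real N" "2 * C / e < real N" using that K by auto
    then have "C < e / 2 * real N" using \<open>0 < e\<close> by (simp add: field_simps)
    then have "\<bar>x N - d * real N\<bar> < e * real N" using C[of N] by (simp add: field_simps)
    moreover have "x N / real N - d = (x N - d * real N) / real N" using N by (simp add: field_simps)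
    ultimately show ?thesis using N by (simp add: field_simps abs_divide)
  qed
  then show "\<exists>K. \<forall>N\<ge>K. norm (x N / real N - d) < e" by blast
qed

lemma idempotent_modulus_split:
  fixes a b :: nat
  assumes "1 \<le> a" "a \<le> b" "[a ^ 2 = a] (mod b)"
  obtains r where "b = gcd a b * r" "0 < r" "coprime (gcd a b) r"
    "\<And>n. [n = a] (mod b) \<longleftrightarrow> gcd a b dvd n \<and> [n = 1] (mod r)"
proof -
  define q where "q = gcd a b"
  obtain r where b: "b = q * r" using gcd_dvd2[of a b] unfolding q_def by (elim dvdE)
  obtain s where a: "a = q * s" using gcd_dvd1[of a b] unfolding q_def by (elim dvdE)
  have q0: "0 < q" using assms by (simp add: q_def)
  have r0: "0 < r" using b assms by (cases r) auto
  have "q * 1 = q * gcd s r"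
    using a b by (metis q_def gcd_mult_distrib_nat mult_1_right)
  then have "gcd s r = 1" using q0 by (metis mult_cancel1 less_irrefl)
  then have "coprime s r" by (rule gcd_eq_1_imp_coprime)
  have "[q * (s * a) = q * s] (mod (q * r))"
    using assms(3) unfolding b power2_eq_square using a by (metis mult.assoc)
  then have "[s * a = s * 1] (mod r)"
    using q0 by (simp add: cong_def mult_mod_right[symmetric])
  then have a1: "[a = 1] (mod r)" 
    using \<open>coprime s r\<close> cong_mult_lcancel_nat[of s r a 1] by (simp add: coprime_commute)
  then have "coprime a r"
    by (metis cong_imp_coprime cong_sym coprime_1_left)
  then have cop: "coprime q r" unfolding a by simp
  have "[n = a] (mod b) \<longleftrightarrow> q dvd n \<and> [n = 1] (mod r)" for n
  proof
    assume n: "[n = a] (mod b)"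
    have "[n = a] (mod q)" "[n = a] (mod r)"
      using n unfolding b by (metis cong_modulus_mult_nat mult.commute)+
    moreover have "q dvd a" using a by simp
    ultimately show "q dvd n \<and> [n = 1] (mod r)" using a1 cong_trans cong_dvd_iff by blast
  next
    assume n: "q dvd n \<and> [n = 1] (mod r)"
    then have "[n = a] (mod q)" using a by (simp add: cong_def mod_eq_0_iff_dvd)
    moreover have "[n = a] (mod r)" using n a1 cong_trans cong_sym by blast
    ultimately show "[n = a] (mod b)" unfolding b using coprime_cong_mult_nat[OF _ _ cop] by blast
  qed
  then show ?thesis using that[of r] b r0 cop unfolding q_def[symmetric] by blast
qed

text \<open>Here \<open>S\<close> is the set of non-units. The products of two non-units are, up to density zero, the
  elements of the monoid that are divisible by \<open>q\<^sup>2\<close>.\<close>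
lemma card_products_approx:
  fixes q r :: nat and S :: "nat set"
  assumes "0 < q" "0 < r" "coprime q r"
    and S: "S = {n. 1 < n \<and> q dvd n \<and> [n = 1] (mod r)}"
    and "0 < (e::real)"
  shows "\<exists>C. \<forall>N. \<bar>real (card ({x * y | x y. x \<in> S \<and> y \<in> S} \<inter> {1..N})) - 1 / real (q\<^sup>2 * r) * real N\<bar>
           \<le> e * real N + C"
proof -
  let ?T = "{x * y | x y. x \<in> S \<and> y \<in> S}"
  let ?K = "{n. q\<^sup>2 dvd n \<and> [n = 1] (mod r)}"
  have cop2: "coprime (q\<^sup>2) r" using assms(3) by simp
  obtain k where k: "[k = 0] (mod q\<^sup>2)" "[k = 1] (mod r)"
    using binary_chinese_remainder_nat[OF cop2] by blast
  have Keq: "?K = {n. [n = k] (mod (q\<^sup>2 * r))}"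
  proof (intro equalityI subsetI)
    fix n assume "n \<in> ?K"
    then have "[n = k] (mod q\<^sup>2)" "[n = k] (mod r)"
      using k by (metis mem_Collect_eq cong_0_iff cong_sym cong_trans)+
    then show "n \<in> {n. [n = k] (mod (q\<^sup>2 * r))}" using coprime_cong_mult_nat[OF _ _ cop2] by blast
  next
    fix n assume "n \<in> {n. [n = k] (mod (q\<^sup>2 * r))}"
    then have "[n = k] (mod q\<^sup>2)" "[n = k] (mod r)"
      by (metis mem_Collect_eq cong_modulus_mult_nat mult.commute)+
    then show "n \<in> ?K" using k cong_trans cong_0_iff by blast
  qed
  have K: "\<bar>real (card (?K \<inter> {1..N})) - 1 / real (q\<^sup>2 * r) * real N\<bar> \<le> 1" for N
    using card_progression[of "q\<^sup>2 * r" k N] assms unfolding Keq by simp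
  have TK: "?T \<subseteq> ?K"
  proof
    fix n assume "n \<in> ?T"
    then obtain x y where n: "n = x * y" "x \<in> S" "y \<in> S" by blast
    then show "n \<in> ?K"
      using cong_mult[of x 1 r y 1] by (auto simp: S power2_eq_square mult_dvd_mono)
  qed
  \<comment> \<open>\<open>q * u\<close> is \<open>1\<close> modulo \<open>r\<close> exactly when \<open>u\<close> is in the class of the inverse \<open>c\<close> of \<open>q\<close>\<close>
  obtain c where c: "[q * c = 1] (mod r)" using cong_solve_coprime_nat[OF assms(3)] by auto
  have "coprime c r"
    using c by (metis cong_imp_coprime cong_sym coprime_1_left coprime_mult_left_iff)
  then have "unavoidable r c" using unavoidable_if_coprime assms(2) by blast
  then obtain U where
    U: "finite U" "\<And>u. u \<in> U \<Longrightarrow> [u = c] (mod r)" "\<And>u. u \<in> U \<Longrightarrow> 1 < u"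
    "\<And>u p. u \<in> U \<Longrightarrow> prime p \<Longrightarrow> p dvd u \<Longrightarrow> 0 < p"
    "upper_density_le {n. \<forall>u\<in>U. \<not> u dvd n} e"
    by (rule unavoidableE[OF _ assms(5), where z = 0]) blast
  let ?V = "{m. \<forall>u\<in>U. \<not> u dvd m}"
  obtain C where C: "\<And>N. real (card (?V \<inter> {1..N})) \<le> e * real N + C"
    using U(5) unfolding upper_density_le_def by blast
  \<comment> \<open>the finitely many \<open>m \<in> U\<close> are set aside because their cofactor \<open>m div u\<close> may be \<open>1\<close>\<close>
  have KT: "?K \<inter> {1..N} \<subseteq> (?T \<inter> {1..N}) \<union> ((\<lambda>m. q\<^sup>2 * m) ` (?V \<inter> {1..N}) \<union> (\<lambda>u. q\<^sup>2 * u) ` U)" for N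
  proof
    fix n assume n: "n \<in> ?K \<inter> {1..N}"
    then obtain m where m: "n = q\<^sup>2 * m" by (auto elim: dvdE)
    have m1: "1 \<le> m" using n m by (cases m) auto
    have "m \<le> n" unfolding m using assms(1) by simp
    then have mN: "m \<le> N" using n by auto
    show "n \<in> (?T \<inter> {1..N}) \<union> ((\<lambda>m. q\<^sup>2 * m) ` (?V \<inter> {1..N}) \<union> (\<lambda>u. q\<^sup>2 * u) ` U)"
    proof (cases "m \<in> ?V \<or> m \<in> U")
      case True
      then show ?thesis using m m1 mN by auto
    next
      case False
      then obtain u where u: "u \<in> U" "u dvd m" by auto
      then obtain v where v: "m = u * v" by (elim dvdE)
      have "v \<noteq> 1" "v \<noteq> 0" using False v u m1 by auto
      then have v1: "1 < v" by simp
      have "[q * u = q * c] (mod r)" using U(2)[OF u(1)] by (intro cong_mult) auto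
      then have qu: "[q * u = 1] (mod r)" using c cong_trans by blast
      have "[(q * u) * (q * v) = 1] (mod r)"
        using n m v by (simp add: power2_eq_square ac_simps)
      moreover have "[(q * u) * (q * v) = 1 * (q * v)] (mod r)" using qu by (intro cong_mult) auto
      ultimately have qv: "[q * v = 1] (mod r)"
        by (metis cong_sym cong_trans mult_1)
      have "1 < q * u" "1 < q * v"
        using assms(1) U(3)[OF u(1)] v1
        by (metis One_nat_def Suc_leI less_le_trans mult_le_mono1 mult_1)+
      then have "q * u \<in> S" "q * v \<in> S" using qu qv by (auto simp: S)
      moreover have "n = (q * u) * (q * v)" using m v by (simp add: power2_eq_square ac_simps)
      ultimately show ?thesis using n by blast
    qed
  qed
  have "\<bar>real (card (?T \<inter> {1..N})) - 1 / real (q\<^sup>2 * r) * real N\<bar> \<le> e * real N + (C + real (card U) + 1)" for N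
  proof -
    have le: "card (?T \<inter> {1..N}) \<le> card (?K \<inter> {1..N})" using TK by (intro card_mono) auto
    have "card (?K \<inter> {1..N}) \<le> card ((?T \<inter> {1..N}) \<union> ((\<lambda>m. q\<^sup>2 * m) ` (?V \<inter> {1..N}) \<union> (\<lambda>u. q\<^sup>2 * u) ` U))"
      using KT U(1) by (intro card_mono) auto
    also have "\<dots> \<le> card (?T \<inter> {1..N}) + (card ((\<lambda>m. q\<^sup>2 * m) ` (?V \<inter> {1..N})) + card ((\<lambda>u. q\<^sup>2 * u) ` U))"
      by (meson card_Un_le add_left_mono le_trans)
    also have "\<dots> \<le> card (?T \<inter> {1..N}) + (card (?V \<inter> {1..N}) + card U)"
      using U(1) by (intro add_mono card_image_le) auto
    finally have "real (card (?K \<inter> {1..N})) \<le> real (card (?T \<inter> {1..N})) + (real (card (?V \<inter> {1..N})) + real (card U))"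
      by linarith
    then show ?thesis using le K[of N] C[of N] by linarith
  qed
  then show ?thesis by blast
qed

theorem theorem1p1:
  fixes a b q :: nat
  assumes "1 \<le> a" and "a \<le> b" and "[a ^ 2 = a] (mod b)"
    and "q = gcd a b"
  shows "(\<lambda>n. real (card (atoms (acm a b) \<inter> {1..n})) / real (card (carrier (acm a b) \<inter> {1..n})))
           \<longlonglongrightarrow> 1 - 1 / real q
         \<and> atomic_density a b = 1 - 1 / real q"
proof -
  obtain r where r: "b = q * r" "0 < r" "coprime q r"
    and cong_iff: "\<And>n. [n = a] (mod b) \<longleftrightarrow> q dvd n \<and> [n = 1] (mod r)"
    by (rule idempotent_modulus_split[OF assms(1-3), folded assms(4)]) blast
  have q0: "0 < q" using assms by simp
  have b0: "0 < b" using assms by simp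
  let ?M = "carrier (acm a b)" and ?A = "atoms (acm a b)"
  define S where "S = {n. 1 < n \<and> q dvd n \<and> [n = 1] (mod r)}"
  let ?T = "{x * y | x y. x \<in> S \<and> y \<in> S}"
  have M: "?M = {n. 1 \<le> n \<and> [n = a] (mod b)} \<union> {1}" by (simp add: acm_def)
  have MS: "?M - Units (acm a b) = S"
    unfolding Units_acm M S_def cong_iff by auto
  have A: "?A = S - ?T"
    unfolding atoms_def MS by (auto simp: acm_def)
  have TS: "?T \<subseteq> S"
  proof
    fix n assume "n \<in> ?T"
    then obtain x y where n: "n = x * y" "x \<in> S" "y \<in> S" by blast
    have "1 < n" unfolding n(1) using n by (intro less_1_mult) (auto simp: S_def)
    then show "n \<in> S" using n cong_mult[of x 1 r y 1] by (auto simp: S_def)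
  qed
  have limT: "(\<lambda>N. real (card (?T \<inter> {1..N})) / real N) \<longlonglongrightarrow> 1 / real (q\<^sup>2 * r)"
    by (intro tendsto_ratio_if_approx card_products_approx[OF q0 r(2,3) S_def])
  have limS: "(\<lambda>N. real (card (S \<inter> {1..N})) / real N) \<longlonglongrightarrow> 1 / real b"
  proof (rule tendsto_ratio_if_approx)
    fix e :: real assume "0 < e"
    have "\<bar>real (card (S \<inter> {1..N})) - 1 / real b * real N\<bar> \<le> e * real N + 2" for N
    proof -
      let ?P = "{n. [n = a] (mod b)} \<inter> {1..N}"
      have "S \<inter> {1..N} \<subseteq> ?P" "?P \<subseteq> insert 1 (S \<inter> {1..N})" unfolding S_def cong_iff by auto
      then have "card (S \<inter> {1..N}) \<le> card ?P" "card ?P \<le> card (insert 1 (S \<inter> {1..N}))"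
        by (auto intro!: card_mono simp del: card_insert_disjoint)
      moreover have "card (insert 1 (S \<inter> {1..N})) \<le> card (S \<inter> {1..N}) + 1"
        by (simp add: card_insert_if)
      moreover have "0 \<le> e * real N" using \<open>0 < e\<close> by simp
      ultimately show ?thesis using card_progression[OF b0, of a N] by (simp del: card_insert_disjoint)
    qed
    then show "\<exists>C. \<forall>N. \<bar>real (card (S \<inter> {1..N})) - 1 / real b * real N\<bar> \<le> e * real N + C" by blast
  qed
  have cardA: "real (card (?A \<inter> {1..N})) = real (card (S \<inter> {1..N})) - real (card (?T \<inter> {1..N}))" for N
  proof -
    have "?A \<inter> {1..N} = (S \<inter> {1..N}) - (?T \<inter> {1..N})" unfolding A by auto
    moreover have "?T \<inter> {1..N} \<subseteq> S \<inter> {1..N}" using TS by auto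
    ultimately have "card (?A \<inter> {1..N}) = card (S \<inter> {1..N}) - card (?T \<inter> {1..N})"
      and "card (?T \<inter> {1..N}) \<le> card (S \<inter> {1..N})"
      by (auto intro!: card_Diff_subset card_mono)
    then show ?thesis by simp
  qed
  have limA: "(\<lambda>N. real (card (?A \<inter> {1..N})) / real N) \<longlonglongrightarrow> 1 / real b - 1 / real (q\<^sup>2 * r)"
    unfolding cardA diff_divide_distrib by (intro tendsto_diff limS limT)
  have cardM: "real (card (?M \<inter> {1..N})) = real (card (S \<inter> {1..N})) + 1" if "1 \<le> N" for N
  proof -
    have "?M \<inter> {1..N} = insert 1 (S \<inter> {1..N})" unfolding M S_def cong_iff using that by auto
    then show ?thesis by (simp add: S_def)
  qed
  have S1: "(\<lambda>N. real (card (S \<inter> {1..N})) / real N + 1 / real N) \<longlonglongrightarrow> 1 / real b + 0"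
    by (intro tendsto_add limS lim_1_over_n)
  have "eventually (\<lambda>N. real (card (S \<inter> {1..N})) / real N + 1 / real N
      = real (card (?M \<inter> {1..N})) / real N) sequentially"
    using eventually_ge_at_top[of 1]
    by eventually_elim (simp only: cardM add_divide_distrib)
  from Lim_transform_eventually[OF S1 this]
  have limM: "(\<lambda>N. real (card (?M \<inter> {1..N})) / real N) \<longlonglongrightarrow> 1 / real b" by simp
  have "(\<lambda>N. (real (card (?A \<inter> {1..N})) / real N) / (real (card (?M \<inter> {1..N})) / real N))
      \<longlonglongrightarrow> (1 / real b - 1 / real (q\<^sup>2 * r)) / (1 / real b)"
    using b0 by (intro tendsto_divide limA limM) simp
  moreover have "(1 / real b - 1 / real (q\<^sup>2 * r)) / (1 / real b) = 1 - 1 / real q"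
    using q0 r(2) unfolding r(1) by (simp add: field_simps power2_eq_square)
  moreover have "eventually (\<lambda>N. (real (card (?A \<inter> {1..N})) / real N) / (real (card (?M \<inter> {1..N})) / real N)
      = real (card (?A \<inter> {1..N})) / real (card (?M \<inter> {1..N}))) sequentially"
    using eventually_gt_at_top[of 0] by eventually_elim simp
  ultimately have lim: "(\<lambda>N. real (card (?A \<inter> {1..N})) / real (card (?M \<inter> {1..N}))) \<longlonglongrightarrow> 1 - 1 / real q"
    using Lim_transform_eventually by fastforce
  then show ?thesis unfolding atomic_density_def using limI by blast
qed

end
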